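(* Consider the finite-horizon multi-flow offloading problem and the dynamic programming algorithm (Algorithm 1) described in the context. The policy $\pi^*=\{\phi_t^*(l_t,\mathbf{b}_t) : t\in\mathcal{T},\ l_t\in\mathcal{L},\ \mathbf{b}_t\in\mathcal{B}\}$ generated by Algorithm 1 is an optimal solution of the problem $$\min_{\pi\in\Pi}\ E_{\mathbf{s}_1}^{\pi}\left[\sum_{t=1}^{T^M} r_t(\mathbf{s}_t^{\pi},\mathbf{a}_t)+\sum_{j\in\mathcal{M}}\hat c_{T^j+1}(\mathbf{s}_{T^j+1}^{\pi})\right],$$ where $\mathbf{s}_t^\pi$ denotes the state at time $t$ when policy $\pi$ is adopted and $\mathbf{a}_t$ is the action that $\pi$ prescribes in that state at time $t$.
   Context: **Data.** A mobile user has flows (files to download) $\mathcal{M}=\{1,\dots,M\}$ with deadlines $T^1\le T^2\le\dots\le T^M$. Time is slotted, with decision epochs $\mathcal{T}=\{1,\dots,T^M\}$. The user moves among finitely many locations $\mathcal{L}=\{1,\dots,L\}$. Flow $j$ has total data size $B^j$, its remaining size lies in $\mathcal{B}^j=[0,B^j]$, and $\mathcal{B}$ denotes the set of vectors of remaining sizes $\mathbf{b}=(b^1,\dots,b^M)$ with $b^j\in\mathcal{B}^j$ for all $j$. **States.** The state at time $t$ is $\mathbf{s}_t=(l_t,\mathbf{b}_t)$, where $l_t\in\mathcal{L}$ is the location and $\mathbf{b}_t=(b_t^1,\dots,b_t^M)\in\mathcal{B}$ is the vector of remaining sizes. **Actions.** The action at time $t$ is $\mathbf{a}_t=(\mathbf{a}_{t,c},\mathbf{a}_{t,w})$,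 where $\mathbf{a}_{t,c}=(a_{t,c}^1,\dots,a_{t,c}^M)$ and $\mathbf{a}_{t,w}=(a_{t,w}^1,\dots,a_{t,w}^M)$ are the data rates (nonnegative amounts of data per slot) allocated to the flows over the cellular network and over the wireless LAN, respectively. In state $(l,\mathbf{b}_t)$ they must satisfy: $a_{t,c}^j\le b_t^j$ and $a_{t,w}^j\le b_t^j$ for all $j$; $\sum_j a_{t,c}^j\le\gamma_c^l$ and $\sum_j a_{t,w}^j\le\gamma_w^l$, where $\gamma_c^l,\gamma_w^l$ are the maximum data rates of the two networks at location $l$; wireless LAN can be used only at locations where it is available (the cellular network is available everywhere); and the two networks are not used at the same time, so the user uses wireless LAN only, cellular only, or stays idle. **Costs.** With $p_c$ the cellular price, $\theta_t$ the user's energy preference at time $t$, and $\varepsilon_c^l,\varepsilon_w^l$ the energy consumption rates of the two networks at location $l$, the cost at time $t$ of action $\mathbf{a}_t$ in state $\mathbf{s}_t=(l,\mathbf{b}_t)$ is $$r_t(\mathbf{s}_t,\mathbf{a}_t)=p_c\sum_{j\in\mathcal{M}}\min\{b_t^j,a_{t,c}^j\}+\theta_t\Big(\varepsilon_c^l\sum_{j\in\mathcal{M}}\min\{b_t^j,a_{t,c}^j\}+\varepsilon_w^l\sum_{j\in\mathcal{M}}\min\{b_t^j,a_{t,w}^j\}\Big).$$ For each $j\in\mathcal{M}$ there is a penalty calculated after deadline $T^j$: $\hat c_{T^j+1}(l_{T^j+1},\mathbf{b}_{T^j+1})=g(\mathbf{b}_{T^j+1})$, where $g$ is a given non-negative non-decreasing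 function. **Transitions.** The probability $p_{l',l}$ that the user moves from location $l$ to location $l'$ in one slot is known in advance. From state $(l,\mathbf{b})$ under action $\mathbf{a}=(\mathbf{a}_c,\mathbf{a}_w)$ the next state is $(l',[\mathbf{b}-\mathbf{a}_c-\mathbf{a}_w]^+)$ with probability $p_{l',l}$, where $[\mathbf{x}]^+=\max\{\mathbf{x},0\}$ componentwise. **Policies.** A policy is a family $\pi=\{\phi_t(l_t,\mathbf{b}_t) : t\in\mathcal{T},\ l_t\in\mathcal{L},\ \mathbf{b}_t\in\mathcal{B}\}$, where $\phi_t$ maps a state to an action at time $t$. $\Pi$ is the set of policies, and $E^\pi_{\mathbf{s}_1}$ is expectation for the process started in state $\mathbf{s}_1$ when policy $\pi$ is used. **Algorithm 1 (optimal policy calculation by backward induction).** Set $\mathcal{V}_{T^M+1}(l,\mathbf{b})=\hat c_{T^M+1}(l,\mathbf{b})=g(\mathbf{b})$ for all $l\in\mathcal{L}$, $\mathbf{b}\in\mathcal{B}$. Then for $t=T^M,T^M-1,\dots,1$, for each $l_t\in\mathcal{L}$, and for $\mathbf{b}_t$ running through $\mathcal{B}$ starting from $0$ in increments of $\sigma$ (where $\sigma>0$ is the granularity of the data size): compute $$\mathcal{Q}_t(\mathbf{s}_t,\mathbf{a}_t)=r_t(\mathbf{s}_t,\mathbf{a}_t)+\sum_{l_{t+1}\in\mathcal{L}}p_{l_{t+1},l_t}\,\mathcal{V}_{t+1}\big(l_{t+1},[\mathbf{b}_t-\mathbf{a}_{t,c}-\mathbf{a}_{t,w}]^+\big),\qquad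 \mathbf{s}_t=(l_t,\mathbf{b}_t),$$ set $\phi_t^*(l_t,\mathbf{b}_t)=\arg\min_{\mathbf{a}_t}\mathcal{Q}_t(\mathbf{s}_t,\mathbf{a}_t)$, and set $\mathcal{V}_t(l_t,\mathbf{b}_t)=\mathcal{Q}_t(\mathbf{s}_t,\phi_t^*(l_t,\mathbf{b}_t))$. The resulting family $\{\phi_t^*\}$ is the policy $\pi^*$; in the transmission phase the user takes the action $\phi_t^*(l_t,\mathbf{b}_t)$ in each slot $t$.
   Formalization: Algorithm 1 as printed ignores all but one copy of the final penalty and is not optimal in general; here V_t also adds the penalty g for each flow j with T^j+1=t (at T^M+1, one copy per flow with the last deadline). With granularity σ, sizes and rates are all multiples of σ. *)

theory Defs
  imports "HOL-Probability.Probability"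
begin

text \<open>
  The finite linearly ordered type \<open>'m\<close> indexes the flows and the finite type \<open>'l\<close> the locations.
  A state is a pair \<open>(l, b)\<close> of a location and a vector of remaining sizes, an action a pair
  \<open>(ac, aw)\<close> of cellular and wireless LAN rate vectors.

  \<open>sizes\<close> is the set of admissible amounts of data: all nonnegative reals, or the multiples of
  a granularity \<open>\<sigma> > 0\<close>; see \<open>valid_offloading\<close>. \<open>move l\<close> is the distribution of the next
  location, so that \<open>pmf (move l) l'\<close> is the probability of moving from \<open>l\<close> to \<open>l'\<close>.
\<close>

type_synonym ('m, 'l) state = "'l \<times> ('m \<Rightarrow> real)"
type_synonym 'm action = "('m \<Rightarrow> real) \<times> ('m \<Rightarrow> real)"
type_synonym ('m, 'l) policy = "nat \<Rightarrow> ('m, 'l) state \<Rightarrow> 'm action"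

record ('m, 'l) offloading =
  deadline :: "'m \<Rightarrow> nat"
  total_size :: "'m \<Rightarrow> real"
  sizes :: "real set"
  cell_cap :: "'l \<Rightarrow> real"
  wlan_cap :: "'l \<Rightarrow> real"
  wlan_locs :: "'l set"
  cell_price :: real
  energy_pref :: "nat \<Rightarrow> real"
  cell_energy :: "'l \<Rightarrow> real"
  wlan_energy :: "'l \<Rightarrow> real"
  pen_fun :: "('m \<Rightarrow> real) \<Rightarrow> real"
  move :: "'l \<Rightarrow> 'l pmf"

definition horizon :: "('m::{finite,linorder}, 'l) offloading \<Rightarrow> nat" where
  "horizon P = deadline P (Max UNIV)"

definition size_vectors :: "('m, 'l) offloading \<Rightarrow> ('m \<Rightarrow> real) set" where
  "size_vectors P = {b. \<forall>j. b j \<in> sizes P \<and> 0 \<le> b j \<and> b j \<le> total_size P j}"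

definition valid_offloading :: "('m::{finite,linorder}, 'l::finite) offloading \<Rightarrow> bool" where
  "valid_offloading P \<longleftrightarrow>
     mono (deadline P) \<and> (\<forall>j. 1 \<le> deadline P j) \<and>
     (\<forall>j. 0 \<le> total_size P j) \<and>
     (sizes P = {0..} \<or> (\<exists>\<sigma>>0. sizes P = range (\<lambda>k::nat. real k * \<sigma>))) \<and>
     (\<forall>l. 0 \<le> cell_cap P l) \<and> (\<forall>l. 0 \<le> wlan_cap P l) \<and>
     (\<forall>b\<in>size_vectors P. 0 \<le> pen_fun P b) \<and> mono_on (size_vectors P) (pen_fun P)"

fun feasible :: "('m::finite, 'l) offloading \<Rightarrow> ('m, 'l) state \<Rightarrow> 'm action \<Rightarrow> bool" where
  "feasible P (l, b) (ac, aw) \<longleftrightarrow>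
     (\<forall>j. ac j \<in> sizes P \<and> 0 \<le> ac j \<and> ac j \<le> b j) \<and>
     (\<forall>j. aw j \<in> sizes P \<and> 0 \<le> aw j \<and> aw j \<le> b j) \<and>
     (\<Sum>j\<in>UNIV. ac j) \<le> cell_cap P l \<and>
     (\<Sum>j\<in>UNIV. aw j) \<le> wlan_cap P l \<and>
     (l \<notin> wlan_locs P \<longrightarrow> (\<forall>j. aw j = 0)) \<and>
     ((\<forall>j. ac j = 0) \<or> (\<forall>j. aw j = 0))"

fun cost :: "('m::finite, 'l) offloading \<Rightarrow> nat \<Rightarrow> ('m, 'l) state \<Rightarrow> 'm action \<Rightarrow> real" where
  "cost P t (l, b) (ac, aw) =
     cell_price P * (\<Sum>j\<in>UNIV. min (b j) (ac j)) +
     energy_pref P t * (cell_energy P l * (\<Sum>j\<in>UNIV. min (b j) (ac j)) +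
                        wlan_energy P l * (\<Sum>j\<in>UNIV. min (b j) (aw j)))"

definition penalty :: "('m, 'l) offloading \<Rightarrow> ('m, 'l) state \<Rightarrow> real" where
  "penalty P s = pen_fun P (snd s)"

definition remaining :: "('m \<Rightarrow> real) \<Rightarrow> 'm action \<Rightarrow> 'm \<Rightarrow> real" where
  "remaining b a = (\<lambda>j. max 0 (b j - fst a j - snd a j))"

definition next_state :: "('m, 'l) offloading \<Rightarrow> ('m, 'l) state \<Rightarrow> 'm action \<Rightarrow> ('m, 'l) state pmf" where
  "next_state P s a = map_pmf (\<lambda>l'. (l', remaining (snd s) a)) (move P (fst s))"

definition policies :: "('m::{finite,linorder}, 'l) offloading \<Rightarrow> ('m, 'l) policy set" where
  "policies P = {\<pi>. \<forall>t\<in>{1..horizon P}. \<forall>l. \<forall>b\<in>size_vectors P. feasible P (l, b) (\<pi> t (l, b))}"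

text \<open>
  \<open>trajectory P \<pi> s n\<close> is the law of the state process from time 1 up to time \<open>n + 1\<close>, started in
  \<open>s\<close> at time 1; the values outside \<open>{1..n + 1}\<close> are irrelevant.
\<close>

primrec trajectory ::
  "('m, 'l) offloading \<Rightarrow> ('m, 'l) policy \<Rightarrow> ('m, 'l) state \<Rightarrow> nat \<Rightarrow> (nat \<Rightarrow> ('m, 'l) state) pmf" where
  "trajectory P \<pi> s 0 = return_pmf (\<lambda>_. s)"
| "trajectory P \<pi> s (Suc n) =
     bind_pmf (trajectory P \<pi> s n) (\<lambda>\<omega>.
       map_pmf (\<lambda>s'. fun_upd \<omega> (Suc (Suc n)) s')
         (next_state P (\<omega> (Suc n)) (\<pi> (Suc n) (\<omega> (Suc n)))))"

definition expected_cost ::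
  "('m::{finite,linorder}, 'l) offloading \<Rightarrow> ('m, 'l) state \<Rightarrow> ('m, 'l) policy \<Rightarrow> real" where
  "expected_cost P s \<pi> =
     measure_pmf.expectation (trajectory P \<pi> s (horizon P)) (\<lambda>\<omega>.
       (\<Sum>t=1..horizon P. cost P t (\<omega> t) (\<pi> t (\<omega> t))) +
       (\<Sum>j\<in>UNIV. penalty P (\<omega> (deadline P j + 1))))"

definition optimal_policy ::
  "('m::{finite,linorder}, 'l) offloading \<Rightarrow> ('m, 'l) state \<Rightarrow> ('m, 'l) policy \<Rightarrow> bool" where
  "optimal_policy P s \<pi> \<longleftrightarrow> is_arg_min (expected_cost P s) (\<lambda>\<pi>'. \<pi>' \<in> policies P) \<pi>"

definition Q_value ::
  "('m::finite, 'l::finite) offloading \<Rightarrow> (nat \<Rightarrow> ('m, 'l) state \<Rightarrow> real) \<Rightarrow>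
     nat \<Rightarrow> ('m, 'l) state \<Rightarrow> 'm action \<Rightarrow> real" where
  "Q_value P V t s a =
     cost P t s a + (\<Sum>l'\<in>UNIV. pmf (move P (fst s)) l' * V (t + 1) (l', remaining (snd s) a))"

text \<open>
  Total penalty charged in state \<open>s\<close> at time \<open>t\<close>: one term for each flow \<open>j\<close> with \<open>T\<^sup>j + 1 = t\<close>.
\<close>

definition penalty_at :: "('m::finite, 'l) offloading \<Rightarrow> nat \<Rightarrow> ('m, 'l) state \<Rightarrow> real" where
  "penalty_at P t s = (\<Sum>j | deadline P j + 1 = t. penalty P s)"

text \<open>
  Backward induction: \<open>\<pi>\<close> is a policy that the algorithm can output, for some way of breaking ties
  in the minimisation. Each penalty has to enter the value function at the time it is charged: with
  \<open>V t\<close> just the minimal \<open>Q\<close>-value and a single copy of the penalty at the end, the algorithm would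
  disregard the other penalties in \<open>expected_cost\<close> and not be optimal in general.
\<close>

definition backward_induction_policy ::
  "('m::{finite,linorder}, 'l::finite) offloading \<Rightarrow> ('m, 'l) policy \<Rightarrow> bool" where
  "backward_induction_policy P \<pi> \<longleftrightarrow> (\<exists>V.
     (\<forall>l. \<forall>b\<in>size_vectors P. V (horizon P + 1) (l, b) = penalty_at P (horizon P + 1) (l, b)) \<and>
     (\<forall>t\<in>{1..horizon P}. \<forall>l. \<forall>b\<in>size_vectors P.
        is_arg_min (Q_value P V t (l, b)) (feasible P (l, b)) (\<pi> t (l, b)) \<and>
        V t (l, b) = Q_value P V t (l, b) (\<pi> t (l, b)) + penalty_at P t (l, b)))"

end

theory Submission
  imports Defs
begin

text \<open>
  Let \<open>V\<close> be the value function of the backward induction. Along any policy, the expectation of the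
  cost and penalties charged up to time \<open>n\<close> plus \<open>V (n + 1)\<close> of the current state is
  nondecreasing in \<open>n\<close>, because \<open>V\<close> is the minimal \<open>Q\<close>-value plus the current penalty; along the
  policy attaining the minima it is constant. It starts at the value \<open>V 1\<close> of the initial state
  and ends at the expected total cost.
\<close>

lemma pmf_expectation_bind_finite:
  fixes f :: "'b \<Rightarrow> real"
  assumes "finite (set_pmf p)" "\<And>x. x \<in> set_pmf p \<Longrightarrow> finite (set_pmf (q x))"
  shows "measure_pmf.expectation (bind_pmf p q) f =
         measure_pmf.expectation p (\<lambda>x. measure_pmf.expectation (q x) f)"
proof -
  have "measure_pmf.expectation (bind_pmf p q) f =
        (\<Sum>x\<in>set_pmf p. pmf p x *\<^sub>R measure_pmf.expectation (q x) f)"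
    using assms by (intro pmf_expectation_bind) auto
  also have "\<dots> = measure_pmf.expectation p (\<lambda>x. measure_pmf.expectation (q x) f)"
    using assms(1) by (subst integral_measure_pmf[of "set_pmf p"]) (auto simp: mult.commute)
  finally show ?thesis .
qed

text \<open>Actions are deterministic, so each step branches only over the finitely many locations.
  Finite support makes every real function of the trajectory integrable.\<close>

lemma finite_set_trajectory:
  fixes P :: "('m, 'l::finite) offloading"
  shows "finite (set_pmf (trajectory P \<pi> s n))"
proof (induction n)
  case (Suc n)
  have "finite (set_pmf (next_state P s' a))" for s' and a
    by (simp add: next_state_def)
  with Suc show ?case by simp
qed simp

text \<open>This keeps the process where feasibility and the value function are specified. It rests
  on \<open>sizes P\<close> being closed under nonnegative differences and on at most one network
  being in use.\<close>

lemma remaining_in_size_vectors: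
  fixes P :: "('m::{finite,linorder}, 'l::finite) offloading"
  assumes "valid_offloading P" "b \<in> size_vectors P" "feasible P (l, b) a"
  shows "remaining b a \<in> size_vectors P"
proof -
  obtain ac aw where a: "a = (ac, aw)" by (cases a)
  have bnd: "0 \<le> b j" "b j \<le> total_size P j" "b j \<in> sizes P" for j
    using assms(2) by (auto simp: size_vectors_def)
  have f: "ac j \<in> sizes P" "0 \<le> ac j" "ac j \<le> b j" "aw j \<in> sizes P" "0 \<le> aw j" "aw j \<le> b j" for j
    using assms(3) by (auto simp: a)
  have diff: "x - y \<in> sizes P" if "x \<in> sizes P" "y \<in> sizes P" "y \<le> x" for x y
  proof (cases "sizes P = {0..}")
    case True
    with that show ?thesis by simp
  next
    case False
    then obtain \<sigma> where \<sigma>: "\<sigma> > 0" "sizes P = range (\<lambda>k::nat. real k * \<sigma>)"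
      using assms(1) unfolding valid_offloading_def by blast
    from that(1,2) obtain i k :: nat where "x = real i * \<sigma>" "y = real k * \<sigma>"
      unfolding \<sigma>(2) by (elim imageE)
    \<comment> \<open>Makes the truncated subtraction of natural numbers below a genuine
      one.\<close>
    moreover from this have "k \<le> i" using that(3) \<sigma>(1) by simp
    ultimately have "x - y = real (i - k) * \<sigma>"
      by (simp add: of_nat_diff left_diff_distrib)
    with \<sigma>(2) show ?thesis by blast
  qed
  \<comment> \<open>Each rate vector is bounded by \<open>b\<close> separately, not their sum. As
    one of them vanishes, the truncation at 0 never takes effect.\<close>
  have "(\<forall>j. ac j = 0) \<or> (\<forall>j. aw j = 0)"
    using assms(3) by (simp add: a)
  then have "remaining b a = (\<lambda>j. b j - aw j) \<or> remaining b a = (\<lambda>j. b j - ac j)"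
    using f by (auto simp: remaining_def a fun_eq_iff max_def)
  moreover have "(\<lambda>j. b j - aw j) \<in> size_vectors P" "(\<lambda>j. b j - ac j) \<in> size_vectors P"
    using f bnd diff by (simp_all add: size_vectors_def add_increasing2 diff_le_eq)
  ultimately show ?thesis by auto
qed

lemma policies_feasible:
  assumes "\<pi> \<in> policies P" "t \<in> {1..horizon P}" "snd s \<in> size_vectors P"
  shows "feasible P s (\<pi> t s)"
  using assms by (cases s) (auto simp: policies_def)

text \<open>Induction on \<open>n\<close>: the state at time \<open>Suc (Suc n)\<close> results from
  the action at time \<open>Suc n\<close>, which is known to be feasible only up to the
  horizon.\<close>

lemma trajectory_in_size_vectors:
  fixes P :: "('m::{finite,linorder}, 'l::finite) offloading"
  assumes "valid_offloading P" "\<pi> \<in> policies P" "snd s \<in> size_vectors P"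
    and "n \<le> horizon P" "\<omega> \<in> set_pmf (trajectory P \<pi> s n)"
  shows "snd (\<omega> (Suc n)) \<in> size_vectors P"
  using assms(4,5)
proof (induction n arbitrary: \<omega>)
  case 0
  with assms(3) show ?case by simp
next
  case (Suc n)
  then obtain \<omega>' l' where \<omega>': "\<omega>' \<in> set_pmf (trajectory P \<pi> s n)"
    and \<omega>: "\<omega> = fun_upd \<omega>' (Suc (Suc n))
               (l', remaining (snd (\<omega>' (Suc n))) (\<pi> (Suc n) (\<omega>' (Suc n))))"
    by (auto simp: next_state_def)
  have "snd (\<omega>' (Suc n)) \<in> size_vectors P"
    using Suc \<omega>' by simp
  then show ?case
    using remaining_in_size_vectors[OF assms(1)]
      policies_feasible[OF assms(2), of "Suc n" "\<omega>' (Suc n)"] Suc.prems(1)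
    by (cases "\<omega>' (Suc n)") (auto simp: \<omega>)
qed

text \<open>Conditioning on the first \<open>n\<close> moves; the sum over the last move has the
  shape of the one in \<open>Q_value\<close>.\<close>

lemma expectation_trajectory_Suc:
  fixes P :: "('m, 'l::finite) offloading" and f :: "(nat \<Rightarrow> ('m, 'l) state) \<Rightarrow> real"
  shows "measure_pmf.expectation (trajectory P \<pi> s (Suc n)) f =
    measure_pmf.expectation (trajectory P \<pi> s n) (\<lambda>\<omega>. \<Sum>l'\<in>UNIV. pmf (move P (fst (\<omega> (Suc n)))) l' *
      f (fun_upd \<omega> (Suc (Suc n)) (l', remaining (snd (\<omega> (Suc n))) (\<pi> (Suc n) (\<omega> (Suc n))))))"
proof -
  have step: "measure_pmf.expectation (map_pmf h (next_state P s' a)) f =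
      (\<Sum>l'\<in>UNIV. pmf (move P (fst s')) l' * f (h (l', remaining (snd s') a)))" for h s' a
    unfolding next_state_def integral_map_pmf by (subst integral_measure_pmf[of UNIV]) simp_all
  show ?thesis
    unfolding trajectory.simps
    by (subst pmf_expectation_bind_finite)
      (simp_all only: finite_set_trajectory step, simp add: next_state_def)
qed

text \<open>Penalties are attached to the time at which they are charged instead of to their flows,
  matching the recursion for the value function.\<close>

definition stage_cost ::
  "('m::finite, 'l::finite) offloading \<Rightarrow> ('m, 'l) policy \<Rightarrow> nat \<Rightarrow> ('m, 'l) state \<Rightarrow> real" where
  "stage_cost P \<pi> t s = cost P t s (\<pi> t s) + penalty_at P t s"

text \<open>Interpolates between the initial value at \<open>n = 0\<close> and the expected total
  cost at the horizon. After \<open>n\<close> decisions the clock stands at \<open>Suc n\<close>, so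
  the last summand stands for everything charged from that time on.\<close>

definition cost_bound ::
  "('m::finite, 'l::finite) offloading \<Rightarrow> (nat \<Rightarrow> ('m, 'l) state \<Rightarrow> real) \<Rightarrow> ('m, 'l) state \<Rightarrow>
     ('m, 'l) policy \<Rightarrow> nat \<Rightarrow> real" where
  "cost_bound P V s \<pi> n = measure_pmf.expectation (trajectory P \<pi> s n)
     (\<lambda>\<omega>. (\<Sum>t=1..n. stage_cost P \<pi> t (\<omega> t)) + V (Suc n) (\<omega> (Suc n)))"

text \<open>Averaging over the last move turns the final cost and the next value into a
  \<open>Q_value\<close>; earlier terms do not depend on that move, and its probabilities sum to 1.
  The result is an expectation under the same law as \<open>cost_bound P V s \<pi> n\<close>, so the
  two can be compared pointwise.\<close>

lemma cost_bound_Suc: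
  fixes P :: "('m::finite, 'l::finite) offloading"
  shows "cost_bound P V s \<pi> (Suc n) = measure_pmf.expectation (trajectory P \<pi> s n)
    (\<lambda>\<omega>. (\<Sum>t=1..n. stage_cost P \<pi> t (\<omega> t)) +
      (Q_value P V (Suc n) (\<omega> (Suc n)) (\<pi> (Suc n) (\<omega> (Suc n))) +
       penalty_at P (Suc n) (\<omega> (Suc n))))"
proof -
  have one: "(\<Sum>l'\<in>UNIV. pmf (move P l) l') = 1" for l
    by (rule sum_pmf_eq_1) auto
  show ?thesis
    unfolding cost_bound_def expectation_trajectory_Suc
    by (intro Bochner_Integration.integral_cong refl)
      (simp add: Q_value_def stage_cost_def penalty_at_def distrib_left sum.distrib
        flip: sum_distrib_right add: one)
qed

lemma expected_cost_eq_cost_bound: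
  fixes P :: "('m::{finite,linorder}, 'l::finite) offloading"
  assumes "valid_offloading P" "\<pi> \<in> policies P" "snd s \<in> size_vectors P"
    and "\<And>l b. b \<in> size_vectors P \<Longrightarrow> V (Suc (horizon P)) (l, b) = penalty_at P (Suc (horizon P)) (l, b)"
  shows "expected_cost P s \<pi> = cost_bound P V s \<pi> (horizon P)"
proof -
  let ?H = "horizon P"
  have dl: "deadline P j \<le> ?H" for j
    using assms(1) by (auto simp: valid_offloading_def horizon_def intro: monoD)
  have "(\<Sum>j\<in>UNIV. penalty P (\<omega> (deadline P j + 1))) = (\<Sum>t=1..Suc ?H. penalty_at P t (\<omega> t))" for \<omega>
  proof -
    \<comment> \<open>Double counting: no deadline exceeds the horizon, so each flow is charged at
      exactly one time of the range. Times up to \<open>?H\<close> go into the stage costs, time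
      \<open>Suc ?H\<close> into the terminal value.\<close>
    have "(\<Sum>t=1..Suc ?H. \<Sum>j\<in>{j \<in> UNIV. deadline P j + 1 = t}. penalty P (\<omega> (deadline P j + 1)))
        = (\<Sum>j\<in>UNIV. penalty P (\<omega> (deadline P j + 1)))"
      using dl by (intro sum.group) auto
    moreover have "(\<Sum>j\<in>{j \<in> UNIV. deadline P j + 1 = t}. penalty P (\<omega> (deadline P j + 1))) =
        penalty_at P t (\<omega> t)" for t
      unfolding penalty_at_def by (rule sum.cong) auto
    ultimately show ?thesis by (simp only:)
  qed
  moreover have "V (Suc ?H) (\<omega> (Suc ?H)) = penalty_at P (Suc ?H) (\<omega> (Suc ?H))"
    if "\<omega> \<in> set_pmf (trajectory P \<pi> s ?H)" for \<omega>
    using assms(4) trajectory_in_size_vectors[OF assms(1-3) order_refl that] by (metis prod.collapse)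
  ultimately show ?thesis
    unfolding expected_cost_def cost_bound_def
    by (intro integral_cong_AE)
      (auto simp: AE_measure_pmf_iff stage_cost_def sum.distrib penalty_at_def)
qed

theorem theorem1:
  fixes P :: "('m::{finite,linorder}, 'l::finite) offloading"
    and \<pi>_star :: "('m, 'l) policy"
    and l\<^sub>1 :: 'l and b\<^sub>1 :: "'m \<Rightarrow> real"
  assumes "valid_offloading P"
    and "b\<^sub>1 \<in> size_vectors P"
    and "backward_induction_policy P \<pi>_star"
  shows "optimal_policy P (l\<^sub>1, b\<^sub>1) \<pi>_star"
proof -
  let ?H = "horizon P" and ?s = "(l\<^sub>1, b\<^sub>1)"
  obtain V where V_end: "\<And>l b. b \<in> size_vectors P \<Longrightarrow>
        V (Suc ?H) (l, b) = penalty_at P (Suc ?H) (l, b)"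
    and V: "\<forall>t\<in>{1..?H}. \<forall>l. \<forall>b\<in>size_vectors P.
        is_arg_min (Q_value P V t (l, b)) (feasible P (l, b)) (\<pi>_star t (l, b)) \<and>
        V t (l, b) = Q_value P V t (l, b) (\<pi>_star t (l, b)) + penalty_at P t (l, b)"
    using assms(3) unfolding backward_induction_policy_def by auto
  have V_star: "V t s = Q_value P V t s (\<pi>_star t s) + penalty_at P t s"
    if "t \<in> {1..?H}" "snd s \<in> size_vectors P" for t s
    using V that by (metis prod.collapse)
  have star: "\<pi>_star \<in> policies P"
    using V by (auto simp: policies_def is_arg_min_def)
  have V_le: "V t s \<le> Q_value P V t s (\<pi> t s) + penalty_at P t s"
    if "\<pi> \<in> policies P" "t \<in> {1..?H}" "snd s \<in> size_vectors P" for \<pi> t s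
  proof -
    have "is_arg_min (Q_value P V t s) (feasible P s) (\<pi>_star t s)"
      using V that by (metis prod.collapse)
    \<comment> \<open>Any policy's action is feasible here, hence a competitor in the
      minimisation.\<close>
    then have "Q_value P V t s (\<pi>_star t s) \<le> Q_value P V t s (\<pi> t s)"
      using policies_feasible[OF that] unfolding is_arg_min_def by (meson not_less)
    then show ?thesis using V_star[OF that(2,3)] by simp
  qed
  note in_sizes = trajectory_in_size_vectors[OF assms(1), where s = ?s]
  have lower: "V 1 ?s \<le> cost_bound P V ?s \<pi> n" if "\<pi> \<in> policies P" "n \<le> ?H" for \<pi> n
    using that(2)
  proof (induction n)
    case 0
    show ?case by (simp add: cost_bound_def)
  next
    case (Suc n)
    \<comment> \<open>By \<open>V_le\<close> the integrands are ordered on the support, where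
      remaining sizes are admissible. The unfoldings are separate so that the right-hand side is
      rewritten by \<open>cost_bound_Suc\<close> before the definition is expanded.\<close>
    have "cost_bound P V ?s \<pi> n \<le> cost_bound P V ?s \<pi> (Suc n)"
      unfolding cost_bound_Suc unfolding cost_bound_def
      using Suc.prems assms(2) in_sizes[OF that(1), of n]
      by (intro integral_mono_AE integrable_measure_pmf_finite finite_set_trajectory)
        (auto simp: AE_measure_pmf_iff intro!: V_le[OF that(1)])
    with Suc show ?case by simp
  qed
  have exact: "cost_bound P V ?s \<pi>_star n = V 1 ?s" if "n \<le> ?H" for n
    using that
  proof (induction n)
    case 0
    show ?case by (simp add: cost_bound_def)
  next
    case (Suc n)
    \<comment> \<open>The same comparison, with equality since \<open>\<pi>_star\<close> attains the
      minima.\<close>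
    have "cost_bound P V ?s \<pi>_star (Suc n) = cost_bound P V ?s \<pi>_star n"
      unfolding cost_bound_Suc unfolding cost_bound_def
      using Suc.prems assms(2) in_sizes[OF star, of n]
      by (intro integral_cong_AE) (auto simp: AE_measure_pmf_iff V_star)
    with Suc show ?case by simp
  qed
  have "expected_cost P ?s \<pi> = cost_bound P V ?s \<pi> ?H" if "\<pi> \<in> policies P" for \<pi>
    using assms(1,2) that V_end by (intro expected_cost_eq_cost_bound) auto
  with star lower exact show ?thesis
    by (auto simp: optimal_policy_def is_arg_min_def not_less)
qed

end
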